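(* Let $\mathbf{k}$ be a field, let $n$ be a positive integer, and let $X=\{x_1,\ldots,x_n\}$. With respect to the degree-lexicographic order on $X^*$ (with $x_1<x_2<\cdots<x_n$), the set $\widetilde{S}$ defined in the context is a Gröbner–Shirshov basis in $\mathbf{k}\langle X\rangle$.
   Context: $Sym_n$ is the symmetric group of degree $n$, $\varepsilon$ is its identity, and $Sym_n^0=Sym_n\setminus\{\varepsilon\}$. $X^*$ is the free monoid on $X$ and $\mathbf{k}\langle X\rangle$ is the free associative (unital) $\mathbf{k}$-algebra on $X$. For $\sigma\in Sym_n$ put $\mathbf{x}_\sigma=x_{\sigma(1)}x_{\sigma(2)}\cdots x_{\sigma(n)}$; in particular $\mathbf{x}_\varepsilon=x_1x_2\cdots x_n$. $X^*$ is ordered by the degree-lexicographic order: compare lengths first, then lexicographically, with $x_1<x_2<\cdots<x_n$. For letters $x_{i_1},\ldots,x_{i_m}\in X$ with $m\ge 2$, $\underline{x_{i_1}x_{i_2}\cdots x_{i_m}}$ denotes the word $x_{j_1}x_{j_2}\cdots x_{j_m}$, where $j_1\le j_2\le\cdots\le j_m$ is the rearrangement of $i_1,\ldots,i_m$ in non-decreasing order. $\widetilde{S}$ is the set of all the following polynomials, for all $\sigma\in Sym_n^0$, all $m\ge 1$, and all $2\le i,i_1,i_2,\ldots,i_{m+1}\le n$: 1. $\mathbf{x}_\sigma-\mathbf{x}_\varepsilon$; 2. $x_i\mathbf{x}_\varepsilon-\mathbf{x}_\varepsilon x_i$; 3. $x_ix_1^m\mathbf{x}_\varepsilon-x_1^m\mathbf{x}_\varepsilon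 x_i$; 4. $\mathbf{x}_\varepsilon x_{i_1}x_{i_2}\cdots x_{i_{m+1}}-\mathbf{x}_\varepsilon\,\underline{x_{i_1}x_{i_2}\cdots x_{i_{m+1}}}$, whenever $x_{i_1}x_{i_2}\cdots x_{i_{m+1}}>\underline{x_{i_1}x_{i_2}\cdots x_{i_{m+1}}}$; 5. $\mathbf{x}_\varepsilon x_{i_1}x_{i_2}\cdots x_{i_m}x_1-x_1\mathbf{x}_\varepsilon x_{i_1}x_{i_2}\cdots x_{i_m}$. Gröbner–Shirshov bases. For nonzero $f\in\mathbf{k}\langle X\rangle$, $\bar f$ is the leading (largest) word of $f$; $f$ is monic if the coefficient of $\bar f$ in $f$ is $1$. $|w|$ is the length of a word $w$. Let $f,g$ be monic. (i) If $w=\bar f b=a\bar g$ for some $a,b\in X^*$ with $|\bar f|+|\bar g|>|w|$, then $(f,g)_w=fb-ag$ is the intersection composition of $f$ and $g$ with respect to $w$. (ii) If $w=\bar f=a\bar g b$ for some $a,b\in X^*$, then $(f,g)_w=f-agb$ is the inclusion composition of $f$ and $g$ with respect to $w$. For a set $T$ of monic polynomials, a composition $(f,g)_w$ is trivial modulo $(T,w)$ if $(f,g)_w=\sum\alpha_i a_is_ib_i$ (finite sum) with $\alpha_i\in\mathbf{k}$, $a_i,b_i\in X^*$, $s_i\in T$ and $a_i\overline{s_i}b_i<w$ for every $i$. The set $T$ is a Gröbner–Shirshov basis in $\mathbf{k}\langle X\rangle$ if every composition $(f,g)_w$ of polynomials $f,g\in T$ is trivial modulo $(T,w)$. *)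

theory Defs
  imports
    "HOL-Library.Poly_Mapping"
    "HOL-Library.List_Lenlexorder"
    "HOL-Combinatorics.Permutations"
begin

text \<open>
  The letter \<open>x\<^sub>i\<close> is represented by its index \<open>i\<close>, so that a word is a list of natural numbers
  and \<open>X\<^sup>*\<close> is \<^term>\<open>lists X\<close>.  The order \<open><\<close> on lists is the one of
  \<^theory>\<open>HOL-Library.List_Lenlexorder\<close>: compare lengths first, then lexicographically.
\<close>

text \<open>
  Making lists a monoid under concatenation turns finitely supported functions on words, with the
  convolution product of \<^theory>\<open>HOL-Library.Poly_Mapping\<close>, into the free associative unital algebra.
\<close>

instantiation list :: (type) monoid_add
begin

definition zero_list :: "'a list" where "zero_list = []"

definition plus_list :: "'a list \<Rightarrow> 'a list \<Rightarrow> 'a list" where "plus_list = (@)"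

instance
  by standard (simp_all add: zero_list_def plus_list_def)

end

type_synonym 'k ncpoly = "nat list \<Rightarrow>\<^sub>0 'k"

definition free_algebra :: "nat set \<Rightarrow> 'k::field ncpoly set" where
  "free_algebra X = {f. Poly_Mapping.keys f \<subseteq> lists X}"

definition mono_word :: "nat list \<Rightarrow> 'k::field ncpoly" where
  "mono_word w = Poly_Mapping.single w 1"

lemma mono_word_mult: "mono_word u * mono_word v = mono_word (u @ v)"
  by (simp add: mono_word_def Poly_Mapping.mult_single plus_list_def)

lemma mono_word_Nil: "mono_word [] = 1"
  by (simp add: mono_word_def zero_list_def flip: single_one)


subsection \<open>Groebner-Shirshov bases\<close>

text \<open>Only meaningful for nonzero polynomials.\<close>
definition lead_word :: "'k::field ncpoly \<Rightarrow> nat list" where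
  "lead_word f = Max (Poly_Mapping.keys f)"

definition monic :: "'k::field ncpoly \<Rightarrow> bool" where
  "monic f \<longleftrightarrow> f \<noteq> 0 \<and> Poly_Mapping.lookup f (lead_word f) = 1"

text \<open>
  \<open>composition X f g w h\<close>: the polynomial \<open>h\<close> is a composition \<open>(f, g)\<^sub>w\<close>.  For given \<open>f\<close>, \<open>g\<close>, \<open>w\<close>
  there may be several of them, one for each way of placing the leading words in \<open>w\<close>.
\<close>
inductive composition ::
  "nat set \<Rightarrow> 'k::field ncpoly \<Rightarrow> 'k ncpoly \<Rightarrow> nat list \<Rightarrow> 'k ncpoly \<Rightarrow> bool"
  for X :: "nat set" and f g :: "'k ncpoly" where
  intersection:
    "\<lbrakk>a \<in> lists X; b \<in> lists X; w = lead_word f @ b; w = a @ lead_word g;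
      length (lead_word f) + length (lead_word g) > length w\<rbrakk>
     \<Longrightarrow> composition X f g w (f * mono_word b - mono_word a * g)"
| inclusion:
    "\<lbrakk>a \<in> lists X; b \<in> lists X; w = lead_word f; w = a @ lead_word g @ b\<rbrakk>
     \<Longrightarrow> composition X f g w (f - mono_word a * g * mono_word b)"

definition trivial_mod ::
  "nat set \<Rightarrow> 'k::field ncpoly set \<Rightarrow> nat list \<Rightarrow> 'k ncpoly \<Rightarrow> bool" where
  "trivial_mod X T w h \<longleftrightarrow>
     (\<exists>(N::nat) (\<alpha> :: nat \<Rightarrow> 'k) a b s.
        (\<forall>j<N. a j \<in> lists X \<and> b j \<in> lists X \<and> s j \<in> T \<and> a j @ lead_word (s j) @ b j < w) \<and>
        h = (\<Sum>j<N. Poly_Mapping.single [] (\<alpha> j) * mono_word (a j) * s j * mono_word (b j)))"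

definition groebner_shirshov_basis :: "nat set \<Rightarrow> 'k::field ncpoly set \<Rightarrow> bool" where
  "groebner_shirshov_basis X T \<longleftrightarrow>
     T \<subseteq> free_algebra X \<and> (\<forall>f\<in>T. monic f) \<and>
     (\<forall>f\<in>T. \<forall>g\<in>T. \<forall>w h. composition X f g w h \<longrightarrow> trivial_mod X T w h)"


subsection \<open>The set of relations\<close>

definition perm_word :: "nat \<Rightarrow> (nat \<Rightarrow> nat) \<Rightarrow> nat list" where
  "perm_word n \<sigma> = map \<sigma> [1..<Suc n]"

abbreviation id_word :: "nat \<Rightarrow> nat list" where
  "id_word n \<equiv> perm_word n id"

text \<open>In the last two rules, \<open>u\<close> is the word \<open>x\<^sub>i\<^sub>1 x\<^sub>i\<^sub>2 \<dots>\<close> of length \<open>m + 1\<close> resp. \<open>m\<close>, with \<open>m \<ge> 1\<close>.\<close>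
inductive_set S_tilde :: "nat \<Rightarrow> 'k::field ncpoly set" for n :: nat where
  perm:
    "\<lbrakk>\<sigma> permutes {1..n}; \<sigma> \<noteq> id\<rbrakk>
     \<Longrightarrow> mono_word (perm_word n \<sigma>) - mono_word (id_word n) \<in> S_tilde n"
| letter:
    "i \<in> {2..n}
     \<Longrightarrow> mono_word ([i] @ id_word n) - mono_word (id_word n @ [i]) \<in> S_tilde n"
| power:
    "\<lbrakk>i \<in> {2..n}; m \<ge> 1\<rbrakk>
     \<Longrightarrow> mono_word ([i] @ replicate m 1 @ id_word n)
          - mono_word (replicate m 1 @ id_word n @ [i]) \<in> S_tilde n"
| sort:
    "\<lbrakk>u \<in> lists {2..n}; length u \<ge> 2; u > List.sort u\<rbrakk>
     \<Longrightarrow> mono_word (id_word n @ u) - mono_word (id_word n @ List.sort u) \<in> S_tilde n"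
| move:
    "\<lbrakk>u \<in> lists {2..n}; length u \<ge> 1\<rbrakk>
     \<Longrightarrow> mono_word (id_word n @ u @ [1]) - mono_word ([1] @ id_word n @ u) \<in> S_tilde n"

end

theory Submission
  imports Defs
begin

text \<open>
  Every element of \<open>S_tilde n\<close> is a difference of two words \<open>l - r\<close> with \<open>l > r\<close>, so it acts as a
  rewriting rule \<open>l \<rightarrow> r\<close> on words, and a composition with respect to \<open>w\<close> is, up to sign, the
  difference of two words \<open>p\<close>, \<open>q\<close> that are both obtained from \<open>w\<close> by a single rewriting step.
  If \<open>p\<close> and \<open>q\<close> rewrite to a common word, then summing up the steps shows that the composition is
  trivial: rewriting decreases words, so every step takes place below \<open>w\<close>.

  No overlap of leading words has to be inspected to find this common word.  Each rule permutes the
  letters, and the right side of each rule contains the factor \<open>z = x\<^sub>1 x\<^sub>2 \<dots> x\<^sub>n\<close>.  Hence \<open>p\<close> and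
  \<open>q\<close> consist of the same letters and both contain \<open>z\<close>.  Any word of the form \<open>a z b\<close>, however,
  rewrites to \<open>x\<^sub>1\<^sup>k z s\<close> with \<open>s\<close> a non-decreasing word in \<open>x\<^sub>2, \<dots>, x\<^sub>n\<close>
  (\<open>rewrites_to_normal_form\<close>): the letters \<open>x\<^sub>i\<close> of \<open>a\<close> with \<open>i \<ge> 2\<close> jump to the right over
  \<open>x\<^sub>1\<^sup>m z\<close>, the letters \<open>x\<^sub>1\<close> of \<open>b\<close> jump to the left over \<open>z\<close>, and what is left behind \<open>z\<close>
  gets sorted.  The multiset of letters determines \<open>k\<close> and \<open>s\<close> (\<open>normal_form_unique\<close>), so \<open>p\<close>
  and \<open>q\<close> have the same normal form.
\<close>


section \<open>The order on words\<close>

lemma append_less_append: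
  fixes u v :: "'a::linorder list"
  assumes "u < v" "length u = length v"
  shows "a @ u @ b < a @ v @ b"
proof -
  have "u @ b < v @ b"
    using assms(1) unfolding list_less_def by (intro lenlex_append1) auto
  then show ?thesis by (induction a) (auto simp: Cons_less_Cons assms(2))
qed

text \<open>
  At the first position where the two words differ, the sorted one has the least of the letters that
  remain.  This orients the relations that sort a word, including those that replace
  \<open>x\<^sub>\<sigma>\<^sub>(\<^sub>1\<^sub>) \<dots> x\<^sub>\<sigma>\<^sub>(\<^sub>n\<^sub>)\<close> by \<open>x\<^sub>1 \<dots> x\<^sub>n\<close>.
\<close>
lemma sorted_rearrangement_le:
  fixes s u :: "'a::linorder list"
  assumes "sorted s" "mset s = mset u"
  shows "s \<le> u"
  using assms
proof (induction s arbitrary: u)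
  case Nil
  then show ?case by simp
next
  case (Cons y ys)
  then obtain x xs where u: "u = x # xs" by (cases u) auto
  have len: "length ys = length xs"
    using mset_eq_length[OF Cons.prems(2)] u by simp
  have "x \<in> set (y # ys)"
    using mset_eq_setD[OF Cons.prems(2)] u by simp
  then have "y \<le> x" using Cons.prems(1) by auto
  moreover have "ys \<le> xs" if "x = y"
    using Cons.IH[of xs] Cons.prems u that by simp
  ultimately show ?case using u len by (auto simp: Cons_le_Cons)
qed


section \<open>The relations as rewriting rules\<close>

lemma id_word_eq: "id_word n = [1..<Suc n]"
  by (simp add: perm_word_def)

lemma mset_perm_word:
  assumes "\<sigma> permutes {1..n}"
  shows "mset (perm_word n \<sigma>) = mset (id_word n)"
proof -
  have "image_mset \<sigma> (mset_set {1..n}) = mset_set {1..n}"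
    using permutes_image[OF assms] permutes_inj_on[OF assms] by (simp add: image_mset_mset_set)
  moreover have "{1..<Suc n} = {1..n}" by auto
  ultimately show ?thesis
    by (simp add: perm_word_def del: upt_Suc)
qed

lemma perm_word_if_mset_eq:
  assumes "mset v = mset (id_word n)"
  obtains \<sigma> where "\<sigma> permutes {1..n}" "v = perm_word n \<sigma>"
proof -
  have len: "length v = n" using mset_eq_length[OF assms] by (simp add: id_word_eq del: upt_Suc)
  have set: "set v = {1..n}"
    using mset_eq_setD[OF assms] by (simp add: id_word_eq atLeastLessThanSuc_atLeastAtMost del: upt_Suc)
  define \<sigma> where "\<sigma> i = (if i \<in> {1..n} then v ! (i - 1) else i)" for i
  have v: "v = perm_word n \<sigma>"
    by (rule nth_equalityI) (simp_all add: len perm_word_def \<sigma>_def nth_append del: upt_Suc)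
  have "set v = \<sigma> ` {1..n}"
    by (subst v) (simp add: perm_word_def atLeastLessThanSuc_atLeastAtMost del: upt_Suc)
  with set have "\<sigma> ` {1..n} = {1..n}" by simp
  then have "bij_betw \<sigma> {1..n} {1..n}"
    unfolding bij_betw_def by (intro conjI eq_card_imp_inj_on) simp_all
  then have "\<sigma> permutes {1..n}"
    by (rule bij_imp_permutes) (auto simp: \<sigma>_def)
  from that[OF this v] show ?thesis .
qed

inductive rewrite_rule :: "nat \<Rightarrow> nat list \<Rightarrow> nat list \<Rightarrow> bool" for n :: nat where
  perm: "\<sigma> permutes {1..n} \<Longrightarrow> \<sigma> \<noteq> id \<Longrightarrow> rewrite_rule n (perm_word n \<sigma>) (id_word n)"
| letter: "i \<in> {2..n} \<Longrightarrow> rewrite_rule n ([i] @ id_word n) (id_word n @ [i])"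
| power: "i \<in> {2..n} \<Longrightarrow> m \<ge> 1 \<Longrightarrow>
    rewrite_rule n ([i] @ replicate m 1 @ id_word n) (replicate m 1 @ id_word n @ [i])"
| sort: "u \<in> lists {2..n} \<Longrightarrow> length u \<ge> 2 \<Longrightarrow> u > List.sort u \<Longrightarrow>
    rewrite_rule n (id_word n @ u) (id_word n @ List.sort u)"
| move: "u \<in> lists {2..n} \<Longrightarrow> length u \<ge> 1 \<Longrightarrow>
    rewrite_rule n (id_word n @ u @ [1]) ([1] @ id_word n @ u)"

lemma S_tilde_iff:
  "f \<in> S_tilde n \<longleftrightarrow> (\<exists>l r. rewrite_rule n l r \<and> f = mono_word l - mono_word r)"
proof
  assume "f \<in> S_tilde n"
  then show "\<exists>l r. rewrite_rule n l r \<and> f = mono_word l - mono_word r"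
    by cases (blast intro: rewrite_rule.intros)+
next
  assume "\<exists>l r. rewrite_rule n l r \<and> f = mono_word l - mono_word r"
  then obtain l r where "rewrite_rule n l r" and f: "f = mono_word l - mono_word r" by blast
  then show "f \<in> S_tilde n"
    unfolding f by cases (simp only:, rule S_tilde.intros; assumption)+
qed

lemma rewrite_rule_mset: "rewrite_rule n l r \<Longrightarrow> mset r = mset l"
proof (induction rule: rewrite_rule.induct)
  case (perm \<sigma>)
  then show ?case using mset_perm_word by metis
qed simp_all

lemma rewrite_rule_contains_id_word:
  assumes "rewrite_rule n l r"
  shows "\<exists>a b. r = a @ id_word n @ b"
  using assms
proof cases
  case perm
  then have "r = [] @ id_word n @ []" by simp
  then show ?thesis by blast
next
  case (letter i)
  then have "r = [] @ id_word n @ [i]" by simp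
  then show ?thesis by blast
next
  case (sort u)
  then have "r = [] @ id_word n @ List.sort u" by simp
  then show ?thesis by blast
qed blast+

lemma id_word_in_lists: "id_word n \<in> lists {1..n}"
  by (simp add: id_word_eq in_lists_conv_set del: upt_Suc)

lemma rewrite_rule_in_lists:
  assumes "rewrite_rule n l r"
  shows "l \<in> lists {1..n}"
  using assms
proof cases
  case (perm \<sigma>)
  then have "set l = set (id_word n)" using mset_eq_setD[OF mset_perm_word] by metis
  with id_word_in_lists show ?thesis by (simp add: in_lists_conv_set)
next
  case (move u)
  then have "n \<ge> 1" by (cases u) auto
  with move id_word_in_lists[of n] show ?thesis by (auto simp: in_lists_conv_set)
qed (use id_word_in_lists[of n] in \<open>auto simp: in_lists_conv_set\<close>)

lemma rewrite_rule_less: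
  assumes "rewrite_rule n l r"
  shows "r < l"
  using assms
proof cases
  case (perm \<sigma>)
  have "id_word n \<le> perm_word n \<sigma>"
    using mset_perm_word[OF perm(3)]
    by (intro sorted_rearrangement_le) (simp_all add: id_word_eq del: upt_Suc)
  moreover have "id_word n \<noteq> perm_word n \<sigma>"
  proof
    assume "id_word n = perm_word n \<sigma>"
    then have "map \<sigma> [1..<Suc n] = map id [1..<Suc n]" by (simp only: perm_word_def)
    then have "\<forall>i\<in>{1..n}. \<sigma> i = i" unfolding map_eq_conv by (simp del: upt_Suc)
    then have "\<sigma> i = i" for i
      using perm(3) by (cases "i \<in> {1..n}") (auto simp: permutes_not_in)
    then have "\<sigma> = id" by (simp add: fun_eq_iff)
    with perm(4) show False ..
  qed
  ultimately show ?thesis using perm by simp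
next
  case (letter i)
  then show ?thesis
    by (simp add: id_word_eq upt_conv_Cons Cons_less_Cons del: upt_Suc)
next
  case (power i m)
  then obtain m' where "m = Suc m'" by (cases m) auto
  with power show ?thesis by (simp add: Cons_less_Cons)
next
  case (sort u)
  then show ?thesis using append_less_append[of "List.sort u" u "id_word n" "[]"] by simp
next
  case (move u)
  (* Both words start with the letter 1; the next letters are 1 and 2, as id_word n has length at
     least 2. *)
  then have "n \<ge> 2" by (cases u) auto
  then have "id_word n = 1 # 2 # [3..<Suc n]"
    by (simp add: id_word_eq upt_conv_Cons numeral_eq_Suc del: upt_Suc)
  then show ?thesis using move by (simp add: Cons_less_Cons)
qed

lemma rewrite_rule_length: "rewrite_rule n l r \<Longrightarrow> length r = length l"
  using rewrite_rule_mset mset_eq_length by metis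

inductive rewrite_step :: "nat \<Rightarrow> nat list \<Rightarrow> nat list \<Rightarrow> bool" for n :: nat where
  "rewrite_rule n l r \<Longrightarrow> a \<in> lists {1..n} \<Longrightarrow> b \<in> lists {1..n} \<Longrightarrow>
   rewrite_step n (a @ l @ b) (a @ r @ b)"

lemma rewrite_step_mset: "rewrite_step n p q \<Longrightarrow> mset q = mset p"
  by (induction rule: rewrite_step.induct) (simp add: rewrite_rule_mset)

lemma rewrite_step_less: "rewrite_step n p q \<Longrightarrow> q < p"
  by (induction rule: rewrite_step.induct)
    (simp add: append_less_append rewrite_rule_less rewrite_rule_length)

lemma rewrites_mset: "(rewrite_step n)\<^sup>*\<^sup>* p q \<Longrightarrow> mset q = mset p"
  by (induction rule: rtranclp_induct) (auto dest: rewrite_step_mset)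

lemma rewrite_step_context:
  assumes "rewrite_step n p q" "c \<in> lists {1..n}" "d \<in> lists {1..n}"
  shows "rewrite_step n (c @ p @ d) (c @ q @ d)"
  using assms
proof cases
  case (1 l r a b)
  then show ?thesis using rewrite_step.intros[of n l r "c @ a" "b @ d"] assms by simp
qed

lemma rewrites_context:
  assumes "(rewrite_step n)\<^sup>*\<^sup>* p q" "c \<in> lists {1..n}" "d \<in> lists {1..n}"
  shows "(rewrite_step n)\<^sup>*\<^sup>* (c @ p @ d) (c @ q @ d)"
  using assms(1)
proof (induction rule: rtranclp_induct)
  case (step y z)
  then show ?case using rewrite_step_context[OF step(2) assms(2,3)]
    by (meson rtranclp.rtrancl_into_rtrancl)
qed simp

lemma rewrites_rule:
  assumes "rewrite_rule n l r"
  shows "(rewrite_step n)\<^sup>*\<^sup>* l r"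
  using rewrite_step.intros[OF assms, of "[]" "[]"] by auto


section \<open>Normal forms of words with a factor \<open>x\<^sub>1 x\<^sub>2 \<dots> x\<^sub>n\<close>\<close>

text \<open>
  Only the letters \<open>x\<^sub>i\<close> with \<open>i \<ge> 2\<close> have to be moved out of the prefix; the letters \<open>x\<^sub>1\<close>
  accumulate in front of \<open>x\<^sub>1 x\<^sub>2 \<dots> x\<^sub>n\<close>.
\<close>
lemma rewrites_clear_prefix:
  assumes "a \<in> lists {1..n}" "b \<in> lists {1..n}"
  shows "\<exists>k v. v \<in> lists {1..n} \<and>
           (rewrite_step n)\<^sup>*\<^sup>* (a @ id_word n @ b) (replicate k 1 @ id_word n @ v)"
  using assms(1)
proof (induction a rule: list.induct)
  case Nil
  then show ?case using assms(2) by (intro exI[of _ 0] exI[of _ b]) simp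
next
  case (Cons x a)
  then have "a \<in> lists {1..n}" by simp
  then obtain k v where v: "v \<in> lists {1..n}" and
    red: "(rewrite_step n)\<^sup>*\<^sup>* (a @ id_word n @ b) (replicate k 1 @ id_word n @ v)"
    using Cons.IH by blast
  have x: "x \<in> {1..n}" using Cons.prems by simp
  have red': "(rewrite_step n)\<^sup>*\<^sup>* ((x # a) @ id_word n @ b) (x # replicate k 1 @ id_word n @ v)"
    using rewrites_context[OF red, of "[x]" "[]"] x by simp
  show ?case
  proof (cases "x = 1")
    case True
    then have "x # replicate k 1 @ id_word n @ v = replicate (Suc k) 1 @ id_word n @ v" by simp
    with red' v show ?thesis by metis
  next
    case False
    with x have i: "x \<in> {2..n}" by auto
    have "rewrite_rule n ([x] @ replicate k 1 @ id_word n) (replicate k 1 @ id_word n @ [x])"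
      using rewrite_rule.letter[OF i] rewrite_rule.power[OF i, of k] by (cases "k = 0") auto
    from rewrites_context[OF rewrites_rule[OF this], of "[]" v] v
    have "(rewrite_step n)\<^sup>*\<^sup>* (x # replicate k 1 @ id_word n @ v) (replicate k 1 @ id_word n @ x # v)"
      by simp
    with red' have "(rewrite_step n)\<^sup>*\<^sup>* ((x # a) @ id_word n @ b) (replicate k 1 @ id_word n @ x # v)"
      by (rule rtranclp_trans)
    moreover have "x # v \<in> lists {1..n}" using v x by simp
    ultimately show ?thesis by blast
  qed
qed

text \<open>
  This is the case \<open>m = 0\<close> of the last family of relations.  It follows from the first family,
  since \<open>x\<^sub>2 \<dots> x\<^sub>n x\<^sub>1\<close> is a rearrangement of \<open>x\<^sub>1 x\<^sub>2 \<dots> x\<^sub>n\<close>.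
\<close>
lemma rewrites_id_word_one:
  assumes "n \<ge> 1"
  shows "(rewrite_step n)\<^sup>*\<^sup>* (id_word n @ [1]) (1 # id_word n)"
proof -
  have unroll: "id_word n = 1 # [2..<Suc n]"
    using assms by (simp add: id_word_eq upt_conv_Cons numeral_2_eq_2 del: upt_Suc)
  have "mset ([2..<Suc n] @ [1]) = mset (id_word n)"
    by (simp add: unroll del: upt_Suc)
  then obtain \<sigma> where \<sigma>: "\<sigma> permutes {1..n}" "[2..<Suc n] @ [1] = perm_word n \<sigma>"
    using perm_word_if_mset_eq by blast
  (* For n = 1 the rearrangement is trivial and no rule is applied. *)
  have "(rewrite_step n)\<^sup>*\<^sup>* ([2..<Suc n] @ [1]) (id_word n)"
    using rewrites_rule[OF rewrite_rule.perm[OF \<sigma>(1)]] \<sigma>(2) by (cases "\<sigma> = id") auto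
  from rewrites_context[OF this, of "[1]" "[]"] assms show ?thesis
    by (simp add: unroll del: upt_Suc)
qed

lemma rewrites_clear_suffix:
  assumes "n \<ge> 1" "v \<in> lists {1..n}"
  shows "\<exists>k u. u \<in> lists {2..n} \<and>
           (rewrite_step n)\<^sup>*\<^sup>* (id_word n @ v) (replicate k 1 @ id_word n @ u)"
  using assms(2)
proof (induction v rule: rev_induct)
  case Nil
  then show ?case by (intro exI[of _ 0] exI[of _ "[]"]) simp
next
  case (snoc y v)
  then have "v \<in> lists {1..n}" by simp
  then obtain k u where u: "u \<in> lists {2..n}" and
    red: "(rewrite_step n)\<^sup>*\<^sup>* (id_word n @ v) (replicate k 1 @ id_word n @ u)"
    using snoc.IH by blast
  have y: "y \<in> {1..n}" using snoc.prems by simp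
  have red': "(rewrite_step n)\<^sup>*\<^sup>* (id_word n @ v @ [y]) (replicate k 1 @ id_word n @ u @ [y])"
    using rewrites_context[OF red, of "[]" "[y]"] y by simp
  show ?case
  proof (cases "y = 1")
    case False
    with y u have "u @ [y] \<in> lists {2..n}" by auto
    with red' show ?thesis by blast
  next
    case True
    have "(rewrite_step n)\<^sup>*\<^sup>* (id_word n @ u @ [1]) (1 # id_word n @ u)"
    proof (cases u)
      case Nil
      then show ?thesis using rewrites_id_word_one[OF assms(1)] by simp
    next
      case (Cons _ _)
      then show ?thesis using rewrites_rule[OF rewrite_rule.move[OF u]] by simp
    qed
    from rewrites_context[OF this, of "replicate k 1" "[]"] assms(1)
    have "(rewrite_step n)\<^sup>*\<^sup>* (replicate k 1 @ id_word n @ u @ [y])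
            (replicate (Suc k) 1 @ id_word n @ u)"
      by (simp add: True replicate_app_Cons_same in_lists_conv_set)
    from rtranclp_trans[OF red' this] u show ?thesis by blast
  qed
qed

lemma rewrites_sort_suffix:
  assumes "u \<in> lists {2..n}"
  shows "(rewrite_step n)\<^sup>*\<^sup>* (id_word n @ u) (id_word n @ List.sort u)"
proof (cases "u = List.sort u")
  case True
  then show ?thesis by simp
next
  case False
  with sorted_rearrangement_le[of "List.sort u" u] have "List.sort u < u" by simp
  moreover have "length u \<ge> 2"
  proof (rule ccontr)
    assume "\<not> length u \<ge> 2"
    then have "sorted u" by (cases u; cases "tl u") auto
    with False show False by (simp add: sorted_sort_id)
  qed
  ultimately show ?thesis using rewrites_rule[OF rewrite_rule.sort[OF assms]] by blast
qed

theorem rewrites_to_normal_form: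
  assumes "n \<ge> 1" "a \<in> lists {1..n}" "b \<in> lists {1..n}"
  shows "\<exists>k s. s \<in> lists {2..n} \<and> sorted s \<and>
           (rewrite_step n)\<^sup>*\<^sup>* (a @ id_word n @ b) (replicate k 1 @ id_word n @ s)"
proof -
  obtain j v where v: "v \<in> lists {1..n}"
    and red1: "(rewrite_step n)\<^sup>*\<^sup>* (a @ id_word n @ b) (replicate j 1 @ id_word n @ v)"
    using rewrites_clear_prefix[OF assms(2,3)] by blast
  obtain k u where u: "u \<in> lists {2..n}"
    and red2: "(rewrite_step n)\<^sup>*\<^sup>* (id_word n @ v) (replicate k 1 @ id_word n @ u)"
    using rewrites_clear_suffix[OF assms(1) v] by blast
  have ones: "replicate i 1 \<in> lists {1..n}" for i
    using assms(1) by (auto simp: in_lists_conv_set)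
  note red1
  also have "(rewrite_step n)\<^sup>*\<^sup>* (replicate j 1 @ id_word n @ v)
                (replicate (j + k) 1 @ id_word n @ u)"
    using rewrites_context[OF red2 ones[of j], of "[]"] by (simp add: replicate_add)
  also have "(rewrite_step n)\<^sup>*\<^sup>* \<dots> (replicate (j + k) 1 @ id_word n @ List.sort u)"
    using rewrites_context[OF rewrites_sort_suffix[OF u] ones[of "j + k"], of "[]"] by simp
  finally show ?thesis using u
    by (intro exI[of _ "j + k"] exI[of _ "List.sort u"]) (simp add: in_lists_conv_set)
qed

text \<open>
  Since \<open>x\<^sub>1\<close> does not occur in the sorted suffix, the number of occurrences of \<open>x\<^sub>1\<close> gives the
  exponent, and cancelling leaves the letters of the suffix.
\<close>
lemma normal_form_unique:
  assumes "s \<in> lists {2..n}" "t \<in> lists {2..n}" "sorted s" "sorted t"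
    and eq: "mset (replicate j 1 @ id_word n @ s) = mset (replicate k 1 @ id_word n @ t)"
  shows "replicate j 1 @ id_word n @ s = replicate k 1 @ id_word n @ t"
proof -
  have no_ones: "count (mset s) 1 = 0" "count (mset t) 1 = 0"
    using assms(1,2) by (auto simp: count_eq_zero_iff)
  have "j + count (mset s) 1 = k + count (mset t) 1"
    using arg_cong[OF eq, of "\<lambda>M. count M 1"] by simp
  then have "j = k" unfolding no_ones by simp
  with eq have "mset s = mset t" by simp
  with assms(3,4) have "s = t" by (metis properties_for_sort)
  with \<open>j = k\<close> show ?thesis by simp
qed

lemma rewrites_confluent:
  assumes "n \<ge> 1" "a \<in> lists {1..n}" "b \<in> lists {1..n}" "c \<in> lists {1..n}" "d \<in> lists {1..n}"
    and eq: "mset (a @ id_word n @ b) = mset (c @ id_word n @ d)"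
  shows "\<exists>q. (rewrite_step n)\<^sup>*\<^sup>* (a @ id_word n @ b) q \<and> (rewrite_step n)\<^sup>*\<^sup>* (c @ id_word n @ d) q"
proof -
  obtain j s where s: "s \<in> lists {2..n}" "sorted s"
    and red1: "(rewrite_step n)\<^sup>*\<^sup>* (a @ id_word n @ b) (replicate j 1 @ id_word n @ s)"
    using rewrites_to_normal_form[OF assms(1-3)] by blast
  obtain k t where t: "t \<in> lists {2..n}" "sorted t"
    and red2: "(rewrite_step n)\<^sup>*\<^sup>* (c @ id_word n @ d) (replicate k 1 @ id_word n @ t)"
    using rewrites_to_normal_form[OF assms(1,4,5)] by blast
  have "replicate j 1 @ id_word n @ s = replicate k 1 @ id_word n @ t"
    using s t rewrites_mset[OF red1] rewrites_mset[OF red2] eq by (intro normal_form_unique) auto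
  with red1 red2 show ?thesis by metis
qed

text \<open>
  Every reduct of \<open>w\<close> has the letters of \<open>w\<close> and contains the right side of the rule that was
  applied, hence the factor \<open>x\<^sub>1 x\<^sub>2 \<dots> x\<^sub>n\<close>, so any two reducts share their normal form.
\<close>
lemma rewrite_steps_joinable:
  assumes "n \<ge> 1" "rewrite_step n w p" "rewrite_step n w q"
  shows "\<exists>r. (rewrite_step n)\<^sup>*\<^sup>* p r \<and> (rewrite_step n)\<^sup>*\<^sup>* q r"
proof -
  have contains: "\<exists>a b. a \<in> lists {1..n} \<and> b \<in> lists {1..n} \<and> p = a @ id_word n @ b"
    if "rewrite_step n w p" for p
    using that
  proof cases
    case (1 l r a b)
    obtain a' b' where r: "r = a' @ id_word n @ b'"
      using rewrite_rule_contains_id_word[OF 1(3)] by blast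
    have "set r = set l"
      using mset_eq_setD[OF rewrite_rule_mset[OF 1(3)]] .
    with rewrite_rule_in_lists[OF 1(3)] have "r \<in> lists {1..n}"
      by (simp add: in_lists_conv_set)
    with r 1 show ?thesis
      by (intro exI[of _ "a @ a'"] exI[of _ "b' @ b"]) simp
  qed
  have "mset p = mset q" using assms(2,3) by (simp add: rewrite_step_mset)
  with contains[OF assms(2)] contains[OF assms(3)] show ?thesis
    using rewrites_confluent[OF assms(1)] by blast
qed


section \<open>From rewriting to trivial compositions\<close>

lemma keys_mono_word_diff:
  assumes "l \<noteq> r"
  shows "Poly_Mapping.keys (mono_word l - mono_word r :: 'k::field ncpoly) = {l, r}"
  using assms
  by (auto simp: in_keys_iff lookup_minus mono_word_def lookup_single when_def split: if_splits)

lemma lead_word_mono_word_diff: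
  assumes "r < l"
  shows "lead_word (mono_word l - mono_word r :: 'k::field ncpoly) = l"
proof -
  have "Poly_Mapping.keys (mono_word l - mono_word r :: 'k ncpoly) = {l, r}"
    using assms by (intro keys_mono_word_diff) auto
  then show ?thesis using assms by (simp add: lead_word_def max_absorb1 order_less_imp_le)
qed

lemma monic_mono_word_diff:
  assumes "r < l"
  shows "monic (mono_word l - mono_word r :: 'k::field ncpoly)"
proof -
  have "Poly_Mapping.lookup (mono_word l - mono_word r :: 'k ncpoly) l = 1"
    using assms by (auto simp: lookup_minus mono_word_def lookup_single when_def)
  moreover from this have "mono_word l - mono_word r \<noteq> (0 :: 'k ncpoly)" by auto
  ultimately show ?thesis by (simp add: monic_def lead_word_mono_word_diff[OF assms])
qed

lemma trivial_mod_zero: "trivial_mod X T w 0"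
  unfolding trivial_mod_def by (intro exI[of _ 0]) auto

lemma trivial_mod_add_term:
  fixes h s :: "'k::field ncpoly"
  assumes "trivial_mod X T w h" "a \<in> lists X" "b \<in> lists X" "s \<in> T" "a @ lead_word s @ b < w"
  shows "trivial_mod X T w (h + Poly_Mapping.single [] c * mono_word a * s * mono_word b)"
proof -
  obtain N and \<alpha> :: "nat \<Rightarrow> 'k" and a' b' s'
    where *: "\<forall>j<N. a' j \<in> lists X \<and> b' j \<in> lists X \<and> s' j \<in> T \<and> a' j @ lead_word (s' j) @ b' j < w"
      and h: "h = (\<Sum>j<N. Poly_Mapping.single [] (\<alpha> j) * mono_word (a' j) * s' j * mono_word (b' j))"
    using assms(1) unfolding trivial_mod_def by blast
  show ?thesis
    unfolding trivial_mod_def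
    by (rule exI[of _ "Suc N"], rule exI[of _ "\<alpha>(N := c)"], rule exI[of _ "a'(N := a)"],
        rule exI[of _ "b'(N := b)"], rule exI[of _ "s'(N := s)"])
      (use * assms h in \<open>auto simp: less_Suc_eq\<close>)
qed

lemma trivial_mod_add_step:
  fixes h :: "'k::field ncpoly"
  assumes "trivial_mod {1..n} (S_tilde n) w h" "rewrite_step n p q" "p < w"
  shows "trivial_mod {1..n} (S_tilde n) w (h + Poly_Mapping.single [] c * (mono_word p - mono_word q))"
  using assms(2)
proof cases
  case (1 l r a b)
  define s :: "'k ncpoly" where "s = mono_word l - mono_word r"
  have "s \<in> S_tilde n" using 1 by (auto simp: S_tilde_iff s_def)
  moreover have "lead_word s = l"
    unfolding s_def using 1 by (simp add: lead_word_mono_word_diff rewrite_rule_less)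
  moreover have "mono_word p - mono_word q = mono_word a * s * mono_word b"
    by (simp add: 1 s_def algebra_simps mono_word_mult)
  ultimately show ?thesis
    using trivial_mod_add_term[OF assms(1), of a b s c] 1 assms(3) by (simp add: mult.assoc)
qed

text \<open>
  The differences along a chain of steps telescope, and since words only decrease along the chain,
  it stays below \<open>w\<close>.
\<close>
lemma trivial_mod_add_rewrites:
  fixes h :: "'k::field ncpoly"
  assumes "trivial_mod {1..n} (S_tilde n) w h" "(rewrite_step n)\<^sup>*\<^sup>* p q" "p < w"
  shows "trivial_mod {1..n} (S_tilde n) w (h + Poly_Mapping.single [] c * (mono_word p - mono_word q))"
proof -
  have "q < w \<and> ?thesis"
    using assms(2)
  proof (induction rule: rtranclp_induct)
    case base
    then show ?case using assms by simp
  next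
    case (step y z)
    then have "z < w" using rewrite_step_less[OF step(2)] by auto
    moreover have "trivial_mod {1..n} (S_tilde n) w (h + Poly_Mapping.single [] c * (mono_word p - mono_word y)
        + Poly_Mapping.single [] c * (mono_word y - mono_word z))"
      using step by (intro trivial_mod_add_step[where p = y]) auto
    ultimately show ?case by (simp add: algebra_simps)
  qed
  then show ?thesis ..
qed

lemma trivial_mod_joinable:
  assumes "(rewrite_step n)\<^sup>*\<^sup>* p r" "(rewrite_step n)\<^sup>*\<^sup>* q r" "p < w" "q < w"
  shows "trivial_mod {1..n} (S_tilde n) w (mono_word p - mono_word q :: 'k::field ncpoly)"
proof -
  have scalars: "Poly_Mapping.single [] 1 = (1 :: 'k ncpoly)"
    "Poly_Mapping.single [] (- 1) = (- 1 :: 'k ncpoly)"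
    by (simp_all add: single_uminus flip: mono_word_Nil mono_word_def)
  have "trivial_mod {1..n} (S_tilde n) w
      (0 + Poly_Mapping.single [] 1 * (mono_word p - mono_word r)
         + Poly_Mapping.single [] (- 1) * (mono_word q - mono_word r) :: 'k ncpoly)"
    using assms by (intro trivial_mod_add_rewrites trivial_mod_zero)
  then show ?thesis by (simp add: scalars)
qed

text \<open>The leading words cancel in a composition, and what remains are two reducts of \<open>w\<close>.\<close>
lemma composition_is_difference_of_reducts:
  fixes h :: "'k::field ncpoly"
  assumes "composition {1..n} f g w h" "f \<in> S_tilde n" "g \<in> S_tilde n"
  obtains p q where "rewrite_step n w p" "rewrite_step n w q" "h = mono_word p - mono_word q"
proof -
  obtain l r where f: "rewrite_rule n l r" "f = mono_word l - mono_word r"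
    using assms(2) by (auto simp: S_tilde_iff)
  obtain l' r' where g: "rewrite_rule n l' r'" "g = mono_word l' - mono_word r'"
    using assms(3) by (auto simp: S_tilde_iff)
  have lead: "lead_word f = l" "lead_word g = l'"
    using f g by (simp_all add: lead_word_mono_word_diff rewrite_rule_less)
  from assms(1) show ?thesis
  proof cases
    case (intersection a b)
    have "rewrite_step n w (a @ r')"
      using rewrite_step.intros[OF g(1), of a "[]"] intersection lead by simp
    moreover have "rewrite_step n w (r @ b)"
      using rewrite_step.intros[OF f(1), of "[]" b] intersection lead by simp
    moreover have "l @ b = a @ l'" using intersection lead by simp
    then have "h = mono_word (a @ r') - mono_word (r @ b)"
      by (simp add: intersection(1) f g algebra_simps mono_word_mult)
    ultimately show ?thesis using that by blast
  next
    case (inclusion a b)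
    have "rewrite_step n w (a @ r' @ b)"
      using rewrite_step.intros[OF g(1), of a b] inclusion lead by simp
    moreover have "rewrite_step n w r"
      using rewrite_step.intros[OF f(1), of "[]" "[]"] inclusion lead by simp
    moreover have "l = a @ l' @ b" using inclusion lead by simp
    then have "h = mono_word (a @ r' @ b) - mono_word r"
      by (simp add: inclusion(1) f g algebra_simps mono_word_mult)
    ultimately show ?thesis using that by blast
  qed
qed

theorem theorem3p2:
  fixes n :: nat
  assumes "n \<ge> 1"
  shows "groebner_shirshov_basis {1..n} (S_tilde n :: 'k::field ncpoly set)"
  unfolding groebner_shirshov_basis_def
proof (intro conjI ballI allI impI subsetI)
  fix f :: "'k ncpoly"
  assume "f \<in> S_tilde n"
  then obtain l r where lr: "rewrite_rule n l r" "f = mono_word l - mono_word r"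
    by (auto simp: S_tilde_iff)
  have less: "r < l" using rewrite_rule_less[OF lr(1)] .
  then show "monic f" unfolding lr(2) by (rule monic_mono_word_diff)
  have "r \<in> lists {1..n}" "l \<in> lists {1..n}"
    using rewrite_rule_in_lists[OF lr(1)] mset_eq_setD[OF rewrite_rule_mset[OF lr(1)]]
    by (simp_all add: in_lists_conv_set)
  then show "f \<in> free_algebra {1..n}"
    using less by (simp add: lr(2) free_algebra_def keys_mono_word_diff)
next
  fix f g h :: "'k ncpoly" and w
  assume "f \<in> S_tilde n" "g \<in> S_tilde n" "composition {1..n} f g w h"
  then obtain p q where pq: "rewrite_step n w p" "rewrite_step n w q"
    and h: "h = mono_word p - mono_word q"
    using composition_is_difference_of_reducts by blast
  obtain r where "(rewrite_step n)\<^sup>*\<^sup>* p r" "(rewrite_step n)\<^sup>*\<^sup>* q r"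
    using rewrite_steps_joinable[OF assms pq] by blast
  then show "trivial_mod {1..n} (S_tilde n) w h"
    unfolding h using pq by (intro trivial_mod_joinable) (auto dest: rewrite_step_less)
qed

end
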